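(* Assume that the covariance matrix $K$ of a centered real Gaussian process $\{X_n\}_{n=0}^{\infty}$ is bounded on $\ell^2$. Then for each $\{a_n\}_{n=0}^{\infty}\in\ell^2$, almost surely the series $\sum_{n=0}^{\infty}a_nX_ne^{in\theta}$ converges for almost every $\theta\in[0,2\pi]$, and for any $\lambda>0$, $$\int_{0}^{2\pi}\exp\Big(\lambda\Big|\sum_{n=0}^{\infty}a_nX_ne^{in\theta}\Big|^2\Big)d\theta<\infty \quad\text{almost surely.}$$
   Context: A real Gaussian process $\{X_n\}_{n=0}^\infty$ is a sequence of real random variables on a common probability space which is jointly Gaussian (every finite linear combination is a Gaussian variable, possibly degenerate); independence is not assumed. It is centered if $\mathbb{E}X_n=0$ for all $n\ge0$. Its covariance matrix is $K=\big(\mathbb{E}((X_m-\mathbb{E}X_m)(X_n-\mathbb{E}X_n))\big)_{n,m\ge0}$; "$K$ is bounded on $\ell^2$" means that this infinite matrix defines a bounded linear operator on $\ell^2$. The sequences $\{a_n\}\in\ell^2$ are complex. *)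

theory Defs
  imports "HOL-Probability.Probability"
begin

(* The almost surely constant case is the degenerate Gaussian of variance 0,
   which has no Lebesgue density. *)
definition gaussian_rv :: "'w measure \<Rightarrow> ('w \<Rightarrow> real) \<Rightarrow> bool" where
  "gaussian_rv M Y \<longleftrightarrow>
     Y \<in> borel_measurable M \<and>
     ((\<exists>\<mu>. AE \<omega> in M. Y \<omega> = \<mu>) \<or>
      (\<exists>\<mu> \<sigma>. 0 < \<sigma> \<and> distributed M lborel Y (\<lambda>x. ennreal (normal_density \<mu> \<sigma> x))))"

definition gaussian_process :: "'w measure \<Rightarrow> (nat \<Rightarrow> 'w \<Rightarrow> real) \<Rightarrow> bool" where
  "gaussian_process M X \<longleftrightarrow>
     (\<forall>n. X n \<in> borel_measurable M) \<and>
     (\<forall>F c. finite F \<longrightarrow> gaussian_rv M (\<lambda>\<omega>. \<Sum>n\<in>F. c n * X n \<omega>))"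

definition centered_process :: "'w measure \<Rightarrow> (nat \<Rightarrow> 'w \<Rightarrow> real) \<Rightarrow> bool" where
  "centered_process M X \<longleftrightarrow> (\<forall>n. (\<integral>\<omega>. X n \<omega> \<partial>M) = 0)"

definition covariance_matrix :: "'w measure \<Rightarrow> (nat \<Rightarrow> 'w \<Rightarrow> real) \<Rightarrow> nat \<Rightarrow> nat \<Rightarrow> real" where
  "covariance_matrix M X m n =
     (\<integral>\<omega>. (X m \<omega> - (\<integral>\<omega>'. X m \<omega>' \<partial>M)) * (X n \<omega> - (\<integral>\<omega>'. X n \<omega>' \<partial>M)) \<partial>M)"

definition ell2 :: "(nat \<Rightarrow> complex) set" where
  "ell2 = {a. summable (\<lambda>n. (cmod (a n))\<^sup>2)}"

definition ell2_norm :: "(nat \<Rightarrow> complex) \<Rightarrow> real" where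
  "ell2_norm a = sqrt (\<Sum>n. (cmod (a n))\<^sup>2)"

definition matrix_apply :: "(nat \<Rightarrow> nat \<Rightarrow> real) \<Rightarrow> (nat \<Rightarrow> complex) \<Rightarrow> nat \<Rightarrow> complex" where
  "matrix_apply K x m = (\<Sum>n. complex_of_real (K m n) * x n)"

(* Convergence of every row series is required explicitly, since suminf is a
   total function; linearity of the operator is then automatic. *)
definition bounded_on_ell2 :: "(nat \<Rightarrow> nat \<Rightarrow> real) \<Rightarrow> bool" where
  "bounded_on_ell2 K \<longleftrightarrow>
     (\<forall>x\<in>ell2. (\<forall>m. summable (\<lambda>n. complex_of_real (K m n) * x n)) \<and> matrix_apply K x \<in> ell2) \<and>
     (\<exists>C. \<forall>x\<in>ell2. ell2_norm (matrix_apply K x) \<le> C * ell2_norm x)"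

definition random_fourier_term ::
    "(nat \<Rightarrow> complex) \<Rightarrow> (nat \<Rightarrow> 'w \<Rightarrow> real) \<Rightarrow> 'w \<Rightarrow> real \<Rightarrow> nat \<Rightarrow> complex" where
  "random_fourier_term a X \<omega> \<theta> n =
     a n * complex_of_real (X n \<omega>) * exp (\<i> * of_nat n * complex_of_real \<theta>)"

end

theory Submission
  imports Defs
begin

text \<open>Carleson's theorem is not needed. For fixed $\theta$ the increments of the partial sums are
  centered Gaussian with variance at most $C \sum |a_k|^2$ over the block of indices, so their fourth
  moments are at most $3 C^2 (\sum |a_k|^2)^2$. The exponent $2 > 1$ gives a maximal inequality by
  bisecting the block, without any logarithmic loss, and hence almost sure convergence for each
  $\theta$; Fubini exchanges the two null sets. For the exponential integral, remove a finite
  number of terms, which are bounded in $\theta$, so that the variance of the remaining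
  tail is small compared with $1 / \lambda$. Fatou's lemma then bounds the expected exponential
  moment of the tail uniformly in $\theta$.\<close>

section \<open>A maximal inequality from fourth moments\<close>

text \<open>The asymmetry is the point. In the bisection argument the factor on \<open>y ^ 4\<close>
  is applied to two halves, each carrying a quarter of the squared weight, so the recursion closes
  only if this factor is below 2. The convexity bound with 8 on both terms would not do; the price
  for 3/2 is the large factor on \<open>x ^ 4\<close>.\<close>

lemma power4_sum_le: "(x + y) ^ 4 \<le> 1000 * x ^ 4 + 3 / 2 * y ^ 4" for x y :: real
proof -
  \<comment> \<open>Young's inequality \<open>2 * p * q <= 9 * p\<^sup>2 + q\<^sup>2 / 9\<close>.
    Applied twice it gives the factors \<open>10 ^ 3\<close> and
    \<open>(10 / 9) ^ 3 = 1000 / 729\<close>, the latter below 3/2.\<close>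
  have sq: "(p + q)\<^sup>2 \<le> 10 * p\<^sup>2 + 10 / 9 * q\<^sup>2" for p q :: real
    using zero_le_power2[of "3 * p - q / 3"] by (simp add: power2_eq_square algebra_simps)
  have "(x + y) ^ 4 = ((x + y)\<^sup>2)\<^sup>2"
    by simp
  also have "\<dots> \<le> (10 * x\<^sup>2 + 10 / 9 * y\<^sup>2)\<^sup>2"
    by (intro power_mono sq) auto
  also have "\<dots> \<le> 10 * (10 * x\<^sup>2)\<^sup>2 + 10 / 9 * (10 / 9 * y\<^sup>2)\<^sup>2"
    by (rule sq)
  also have "\<dots> = 1000 * x ^ 4 + 1000 / 729 * y ^ 4"
    by (simp add: power_mult_distrib power_divide)
  also have "1000 / 729 * y ^ 4 \<le> 3 / 2 * y ^ 4"
    by (intro mult_right_mono) auto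
  finally show ?thesis by simp
qed

text \<open>Take for \<open>h\<close> the first index at which the accumulated weight reaches one
  half. The index \<open>h\<close> itself is left out of both halves, because its weight alone may
  exceed half of the total.\<close>

lemma exists_bisection:
  fixes u :: "nat \<Rightarrow> real"
  assumes u: "\<And>k. 0 \<le> u k" and "i < j"
  obtains h where "i \<le> h" "h < j" "sum u {i..<h} \<le> sum u {i..<j} / 2"
    "sum u {Suc h..<j} \<le> sum u {i..<j} / 2"
proof -
  define P where "P h \<longleftrightarrow> i \<le> h \<and> sum u {i..<j} / 2 \<le> sum u {i..<Suc h}" for h
  define h where "h = (LEAST h. P h)"
  have "P (j - 1)"
    using \<open>i < j\<close> sum_nonneg[of "{i..<j}" u] u by (auto simp: P_def)
  then have Ph: "P h" and "h \<le> j - 1"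
    unfolding h_def by (rule LeastI, rule Least_le)
  then have h: "i \<le> h" "h < j"
    using \<open>i < j\<close> by (auto simp: P_def)
  have "sum u {i..<h} \<le> sum u {i..<j} / 2"
  \<comment> \<open>For \<open>h = i\<close> the left half is empty; minimality says nothing about
    \<open>i - 1\<close>, since \<open>P\<close> demands \<open>i \<le> h\<close>.\<close>
  proof (cases "h = i")
    case True
    then show ?thesis using u by (simp add: sum_nonneg)
  next
    case False
    then have "\<not> P (h - 1)"
      using h unfolding h_def by (intro not_less_Least) auto
    then show ?thesis
      using h False by (auto simp: P_def)
  qed
  moreover have "sum u {i..<j} = sum u {i..<Suc h} + sum u {Suc h..<j}"
    using h by (intro sum.atLeastLessThan_concat[symmetric]) auto
  then have "sum u {Suc h..<j} \<le> sum u {i..<j} / 2"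
    using Ph by (auto simp: P_def)
  ultimately show ?thesis
    using that h by blast
qed

text \<open>Each half of the bisected block carries at most a quarter of the squared weight, so the
  constant has to satisfy $A = 1000 + 2 \cdot (3/2) \cdot A/4$.\<close>

lemma fourth_moment_maximal_inequality:
  fixes Y :: "nat \<Rightarrow> 'a \<Rightarrow> real" and u :: "nat \<Rightarrow> real"
  assumes Y[measurable]: "\<And>k. Y k \<in> borel_measurable M"
    and u: "\<And>k. 0 \<le> u k"
    and moment: "\<And>i j. (\<integral>\<^sup>+\<omega>. ennreal ((\<Sum>k=i..<j. Y k \<omega>) ^ 4) \<partial>M) \<le> ennreal ((sum u {i..<j})\<^sup>2)"
  shows "(\<integral>\<^sup>+\<omega>. (SUP m\<in>{i..j}. ennreal ((\<Sum>k=i..<m. Y k \<omega>) ^ 4)) \<partial>M)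
    \<le> ennreal (4000 * (sum u {i..<j})\<^sup>2)"
proof (induction "j - i" arbitrary: i j rule: less_induct)
  case less
  define S where "S i j \<omega> = (\<Sum>k=i..<j. Y k \<omega>)" for i j :: nat and \<omega>
  define P where "P i j \<omega> = (SUP m\<in>{i..j}. ennreal (S i m \<omega> ^ 4))" for i j :: nat and \<omega>
  have [measurable]: "S i j \<in> borel_measurable M" for i j
    unfolding S_def by measurable
  have [measurable]: "P i j \<in> borel_measurable M" for i j
    unfolding P_def by measurable
  have IH: "(\<integral>\<^sup>+\<omega>. P i' j' \<omega> \<partial>M) \<le> ennreal (4000 * (sum u {i'..<j'})\<^sup>2)" if "j' - i' < j - i" for i' j'
    using less[OF that] by (simp add: P_def S_def)
  have "(\<integral>\<^sup>+\<omega>. P i j \<omega> \<partial>M) \<le> ennreal (4000 * (sum u {i..<j})\<^sup>2)"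
  proof (cases "i < j")
    \<comment> \<open>For \<open>j < i\<close> the supremum runs over the empty set and is
      \<open>bot\<close>, that is 0; for \<open>i = j\<close> it sees only the empty sum.\<close>
    case False
    then have "P i j \<omega> = 0" for \<omega>
      by (cases "i = j") (auto simp: P_def S_def bot_ennreal)
    then show ?thesis by simp
  next
    case True
    obtain h where h: "i \<le> h" "h < j"
      and L: "sum u {i..<h} \<le> sum u {i..<j} / 2" and R: "sum u {Suc h..<j} \<le> sum u {i..<j} / 2"
      by (rule exists_bisection[OF u True])
    define U where "U = sum u {i..<j}"
    have sq: "(sum u {i..<h})\<^sup>2 \<le> U\<^sup>2 / 4" "(sum u {Suc h..<j})\<^sup>2 \<le> U\<^sup>2 / 4"
      using power_mono[OF L, of 2] power_mono[OF R, of 2] u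
      by (auto simp: U_def power_divide sum_nonneg)
    have U1: "(sum u {i..<Suc h})\<^sup>2 \<le> U\<^sup>2"
      unfolding U_def using h u by (intro power_mono sum_mono2 sum_nonneg) auto
    \<comment> \<open>A partial sum ending at \<open>m \<le> h\<close> stays inside the left half;
      any later one is the fixed sum through \<open>h\<close> plus a partial sum of the right half.
      Adding the two maxima instead of taking the larger one lets the integral be split.\<close>
    have "P i j \<omega> \<le> ennreal 1000 * ennreal (S i (Suc h) \<omega> ^ 4)
        + (ennreal (3 / 2) * P i h \<omega> + ennreal (3 / 2) * P (Suc h) j \<omega>)" for \<omega>
      unfolding P_def[of i j]
    proof (rule SUP_least)
      fix m assume m: "m \<in> {i..j}"
      show "ennreal (S i m \<omega> ^ 4) \<le> ennreal 1000 * ennreal (S i (Suc h) \<omega> ^ 4)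
        + (ennreal (3 / 2) * P i h \<omega> + ennreal (3 / 2) * P (Suc h) j \<omega>)"
      proof (cases "m \<le> h")
        case True
        then have "ennreal (S i m \<omega> ^ 4) \<le> P i h \<omega>"
          unfolding P_def using m by (intro SUP_upper) auto
        also have "\<dots> \<le> ennreal (3 / 2) * P i h \<omega>"
          using mult_right_mono[of 1 "ennreal (3 / 2)" "P i h \<omega>"] by (simp del: ennreal_numeral)
        also have "\<dots> \<le> ennreal 1000 * ennreal (S i (Suc h) \<omega> ^ 4)
            + (ennreal (3 / 2) * P i h \<omega> + ennreal (3 / 2) * P (Suc h) j \<omega>)"
          by (metis add_increasing add_increasing2 order_refl zero_le)
        finally show ?thesis .
      next
        case False
        then have "S i m \<omega> = S i (Suc h) \<omega> + S (Suc h) m \<omega>"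
          using h unfolding S_def by (intro sum.atLeastLessThan_concat[symmetric]) auto
        then have "S i m \<omega> ^ 4 \<le> 1000 * S i (Suc h) \<omega> ^ 4 + 3 / 2 * S (Suc h) m \<omega> ^ 4"
          using power4_sum_le by simp
        then have "ennreal (S i m \<omega> ^ 4) \<le> ennreal (1000 * S i (Suc h) \<omega> ^ 4 + 3 / 2 * S (Suc h) m \<omega> ^ 4)"
          by (rule ennreal_leI)
        also have "\<dots> = ennreal 1000 * ennreal (S i (Suc h) \<omega> ^ 4) + ennreal (3 / 2) * ennreal (S (Suc h) m \<omega> ^ 4)"
          by (subst ennreal_plus) (simp_all only: ennreal_mult' zero_le_numeral, auto)
        also have "ennreal (S (Suc h) m \<omega> ^ 4) \<le> P (Suc h) j \<omega>"
          unfolding P_def using m False by (intro SUP_upper) auto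
        finally have "ennreal (S i m \<omega> ^ 4) \<le> ennreal 1000 * ennreal (S i (Suc h) \<omega> ^ 4)
            + ennreal (3 / 2) * P (Suc h) j \<omega>"
          by (simp add: add_left_mono mult_left_mono)
        also have "\<dots> \<le> ennreal 1000 * ennreal (S i (Suc h) \<omega> ^ 4)
            + (ennreal (3 / 2) * P i h \<omega> + ennreal (3 / 2) * P (Suc h) j \<omega>)"
          by (intro add_left_mono) simp
        finally show ?thesis .
      qed
    qed
    then have "(\<integral>\<^sup>+\<omega>. P i j \<omega> \<partial>M) \<le> (\<integral>\<^sup>+\<omega>. ennreal 1000 * ennreal (S i (Suc h) \<omega> ^ 4)
        + (ennreal (3 / 2) * P i h \<omega> + ennreal (3 / 2) * P (Suc h) j \<omega>) \<partial>M)"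
      by (intro nn_integral_mono)
    also have "\<dots> = ennreal 1000 * (\<integral>\<^sup>+\<omega>. ennreal (S i (Suc h) \<omega> ^ 4) \<partial>M)
        + (ennreal (3 / 2) * (\<integral>\<^sup>+\<omega>. P i h \<omega> \<partial>M) + ennreal (3 / 2) * (\<integral>\<^sup>+\<omega>. P (Suc h) j \<omega> \<partial>M))"
      by (simp add: nn_integral_add nn_integral_cmult del: ennreal_numeral)
    \<comment> \<open>The first term is controlled by the moment hypothesis alone; by induction each
      half contributes at most \<open>4000 * (U\<^sup>2 / 4)\<close>.\<close>
    also have "\<dots> \<le> ennreal 1000 * ennreal (U\<^sup>2)
        + (ennreal (3 / 2) * ennreal (1000 * U\<^sup>2) + ennreal (3 / 2) * ennreal (1000 * U\<^sup>2))"
    proof (intro add_mono mult_left_mono)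
      show "(\<integral>\<^sup>+\<omega>. ennreal (S i (Suc h) \<omega> ^ 4) \<partial>M) \<le> ennreal (U\<^sup>2)"
        unfolding S_def using moment ennreal_leI[OF U1] by (rule order_trans)
      show "(\<integral>\<^sup>+\<omega>. P i h \<omega> \<partial>M) \<le> ennreal (1000 * U\<^sup>2)"
        using h sq(1) by (intro order_trans[OF IH]) (auto intro!: ennreal_leI)
      show "(\<integral>\<^sup>+\<omega>. P (Suc h) j \<omega> \<partial>M) \<le> ennreal (1000 * U\<^sup>2)"
        using h sq(2) by (intro order_trans[OF IH]) (auto intro!: ennreal_leI)
    qed auto
    also have "\<dots> = ennreal (1000 * U\<^sup>2 + (3 / 2 * (1000 * U\<^sup>2) + 3 / 2 * (1000 * U\<^sup>2)))"
      by (simp add: ennreal_mult'[symmetric] ennreal_plus[symmetric] del: ennreal_plus ennreal_numeral)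
    finally show ?thesis
      by (simp add: U_def)
  qed
  then show ?case
    by (simp add: P_def S_def)
qed

text \<open>The supremum \<open>D i\<close> over all blocks that start at \<open>i\<close> has
  integral at most \<open>4000 * (r i)\<^sup>2\<close>, where \<open>r i\<close> is the remainder of
  the convergent series of weights. Hence the infimum of \<open>D i\<close> over \<open>i\<close>
  has integral 0 and vanishes almost everywhere, which is the Cauchy criterion in disguise.\<close>

lemma AE_summable_if_fourth_moments:
  fixes Y :: "nat \<Rightarrow> 'a \<Rightarrow> real" and u :: "nat \<Rightarrow> real"
  assumes Y[measurable]: "\<And>k. Y k \<in> borel_measurable M"
    and u: "\<And>k. 0 \<le> u k" "summable u"
    and moment: "\<And>i j. (\<integral>\<^sup>+\<omega>. ennreal ((\<Sum>k=i..<j. Y k \<omega>) ^ 4) \<partial>M) \<le> ennreal ((sum u {i..<j})\<^sup>2)"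
  shows "AE \<omega> in M. summable (\<lambda>k. Y k \<omega>)"
proof -
  define S where "S i j \<omega> = (\<Sum>k=i..<j. Y k \<omega>)" for i j :: nat and \<omega>
  have [measurable]: "S i j \<in> borel_measurable M" for i j
    unfolding S_def by measurable
  define D where "D i \<omega> = (SUP m\<in>{i..}. ennreal (S i m \<omega> ^ 4))" for i \<omega>
  have [measurable]: "D i \<in> borel_measurable M" for i
    unfolding D_def by measurable
  define r where "r i = (\<Sum>k. u (k + i))" for i
  have D_le: "(\<integral>\<^sup>+\<omega>. D i \<omega> \<partial>M) \<le> ennreal (4000 * (r i)\<^sup>2)" for i
  proof -
    \<comment> \<open>The maximal inequality covers finite blocks only; this form is an increasing
      limit in \<open>j\<close>, so monotone convergence carries the bound over.\<close>
    have "D i \<omega> = (SUP j. SUP m\<in>{i..j}. ennreal (S i m \<omega> ^ 4))" for \<omega>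
    proof (rule antisym)
      show "D i \<omega> \<le> (SUP j. SUP m\<in>{i..j}. ennreal (S i m \<omega> ^ 4))"
        unfolding D_def by (intro SUP_least) (auto intro!: SUP_upper2)
      show "(SUP j. SUP m\<in>{i..j}. ennreal (S i m \<omega> ^ 4)) \<le> D i \<omega>"
        unfolding D_def by (intro SUP_least SUP_upper) auto
    qed
    then have "(\<integral>\<^sup>+\<omega>. D i \<omega> \<partial>M) = (\<integral>\<^sup>+\<omega>. (SUP j. SUP m\<in>{i..j}. ennreal (S i m \<omega> ^ 4)) \<partial>M)"
      by simp
    also have "\<dots> = (SUP j. \<integral>\<^sup>+\<omega>. (SUP m\<in>{i..j}. ennreal (S i m \<omega> ^ 4)) \<partial>M)"
      by (intro nn_integral_monotone_convergence_SUP)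
        (auto simp: incseq_def le_fun_def intro!: SUP_subset_mono)
    also have "\<dots> \<le> ennreal (4000 * (r i)\<^sup>2)"
    proof (rule SUP_least)
      fix j
      have "sum u {i..<j} = sum (\<lambda>k. u (k + i)) {0..<j - i}"
        by (cases "i \<le> j") (auto simp: sum.atLeastLessThan_shift_0[of _ i] add.commute)
      also have "\<dots> \<le> r i"
        unfolding r_def using u by (intro sum_le_suminf summable_ignore_initial_segment) auto
      finally have "(sum u {i..<j})\<^sup>2 \<le> (r i)\<^sup>2"
        using u by (intro power_mono) (auto intro: sum_nonneg)
      then show "(\<integral>\<^sup>+\<omega>. (SUP m\<in>{i..j}. ennreal (S i m \<omega> ^ 4)) \<partial>M) \<le> ennreal (4000 * (r i)\<^sup>2)"
        unfolding S_def
        by (intro order_trans[OF fourth_moment_maximal_inequality[OF Y u(1) moment]] ennreal_leI) auto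
    qed
    finally show ?thesis .
  qed
  have "(\<lambda>i. ennreal (4000 * (r i)\<^sup>2)) \<longlonglongrightarrow> ennreal (4000 * 0\<^sup>2)"
    unfolding r_def by (intro tendsto_ennrealI tendsto_intros suminf_exist_split2 u)
  then have lim: "(\<lambda>i. ennreal (4000 * (r i)\<^sup>2)) \<longlonglongrightarrow> 0"
    by simp
  have "(\<integral>\<^sup>+\<omega>. (INF i. D i \<omega>) \<partial>M) \<le> ennreal (4000 * (r i)\<^sup>2)" for i
    by (intro order_trans[OF nn_integral_mono D_le[of i]] INF_lower) auto
  then have "(\<integral>\<^sup>+\<omega>. (INF i. D i \<omega>) \<partial>M) \<le> 0"
    by (intro LIMSEQ_le_const[OF lim]) auto
  then have "AE \<omega> in M. (INF i. D i \<omega>) = 0"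
    by (subst nn_integral_0_iff_AE[symmetric]) auto
  then show ?thesis
  proof eventually_elim
    fix \<omega> assume inf0: "(INF i. D i \<omega>) = 0"
    show "summable (\<lambda>k. Y k \<omega>)"
      unfolding summable_Cauchy
    proof (intro allI impI)
      fix e :: real assume "0 < e"
      \<comment> \<open>Half of \<open>e\<close> suffices as a threshold because a block from
        \<open>m\<close> to \<open>n\<close> is the difference of two blocks that start at
        \<open>i\<close>.\<close>
      then have "(INF i. D i \<omega>) < ennreal ((e / 2) ^ 4)"
        using inf0 by simp
      then obtain i where i: "D i \<omega> < ennreal ((e / 2) ^ 4)"
        by (auto simp: INF_less_iff)
      have small: "\<bar>S i m \<omega>\<bar> < e / 2" if "i \<le> m" for m
      proof -
        have "ennreal (S i m \<omega> ^ 4) \<le> D i \<omega>"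
          unfolding D_def using that by (intro SUP_upper) auto
        then have "S i m \<omega> ^ 4 < (e / 2) ^ 4"
          using i by (metis ennreal_less_iff le_less_trans zero_le_even_power even_numeral)
        then have "\<bar>S i m \<omega>\<bar> ^ 4 < (e / 2) ^ 4"
          by simp
        then show ?thesis
          by (rule power_less_imp_less_base) (use \<open>0 < e\<close> in auto)
      qed
      have "norm (\<Sum>k=m..<n. Y k \<omega>) < e" if "i \<le> m" for m n
      proof (cases "m \<le> n")
        case True
        then have "S i n \<omega> = S i m \<omega> + (\<Sum>k=m..<n. Y k \<omega>)"
          using that unfolding S_def by (intro sum.atLeastLessThan_concat[symmetric]) auto
        then show ?thesis
          using small[of m] small[of n] abs_triangle_ineq4[of "S i n \<omega>" "S i m \<omega>"] that True by simp
      next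
        case False
        then show ?thesis using \<open>0 < e\<close> by simp
      qed
      then show "\<exists>N. \<forall>m\<ge>N. \<forall>n. norm (\<Sum>k=m..<n. Y k \<omega>) < e"
        by blast
    qed
  qed
qed

section \<open>Moments of centered Gaussian variables\<close>

text \<open>In both alternatives of \<open>gaussian_rv\<close> the parameter \<mu> is the
  expectation, so it must be 0. This serves as a case rule for the moment computations.\<close>

lemma (in prob_space) centered_gaussian_cases:
  assumes "gaussian_rv M Y" and "expectation Y = 0"
  obtains (zero) "AE \<omega> in M. Y \<omega> = 0"
  | (normal) \<sigma> where "0 < \<sigma>" "distributed M lborel Y (\<lambda>x. ennreal (normal_density 0 \<sigma> x))"
proof -
  have [measurable]: "Y \<in> borel_measurable M"
    using assms(1) by (simp add: gaussian_rv_def)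
  consider \<mu> where "AE \<omega> in M. Y \<omega> = \<mu>"
    | \<mu> \<sigma> where "0 < \<sigma>" "distributed M lborel Y (\<lambda>x. ennreal (normal_density \<mu> \<sigma> x))"
    using assms(1) by (auto simp: gaussian_rv_def)
  then show ?thesis
  proof cases
    case 1
    then have "expectation Y = expectation (\<lambda>_. \<mu>)"
      by (intro integral_cong_AE) auto
    then show ?thesis
      using assms(2) 1 by (intro that(1)) (simp add: prob_space)
  next
    case 2
    then have "expectation Y = \<mu>"
      by (rule normal_distributed_expectation)
    then show ?thesis
      using assms(2) 2 by (intro that(2)) auto
  qed
qed

text \<open>All bounds depend on the second moment only and include the degenerate case. In the last
  one 1/4 is half of the critical value 1/2: for variance \<open>\<sigma>\<^sup>2\<close> the exact
  integral is \<open>1 / sqrt (1 - 2 * t * \<sigma>\<^sup>2)\<close>, which is then at most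
  \<open>sqrt 2\<close>.\<close>

lemma (in prob_space) centered_gaussian_moments:
  assumes Y: "gaussian_rv M Y" and mean: "expectation Y = 0"
  shows "integrable M (\<lambda>\<omega>. (Y \<omega>)\<^sup>2)"
    and "(\<integral>\<^sup>+\<omega>. ennreal (Y \<omega> ^ 4) \<partial>M) = ennreal (3 * (expectation (\<lambda>\<omega>. (Y \<omega>)\<^sup>2))\<^sup>2)"
    and "0 \<le> t \<Longrightarrow> t * expectation (\<lambda>\<omega>. (Y \<omega>)\<^sup>2) \<le> 1 / 4 \<Longrightarrow>
      (\<integral>\<^sup>+\<omega>. ennreal (exp (t * (Y \<omega>)\<^sup>2)) \<partial>M) \<le> ennreal (sqrt 2)"
proof -
  have [measurable]: "Y \<in> borel_measurable M"
    using Y by (simp add: gaussian_rv_def)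
  show "integrable M (\<lambda>\<omega>. (Y \<omega>)\<^sup>2)"
  using Y mean proof (cases rule: centered_gaussian_cases)
    case zero
    then have "integrable M (\<lambda>\<omega>. (Y \<omega>)\<^sup>2) \<longleftrightarrow> integrable M (\<lambda>\<omega>. 0 :: real)"
      by (intro integrable_cong_AE) auto
    then show ?thesis by simp
  next
    case (normal \<sigma>)
    then show ?thesis
      using integrable_normal_moment[of \<sigma> 0 2]
      by (subst distributed_integrable[OF normal(2), symmetric]) auto
  qed
  show "(\<integral>\<^sup>+\<omega>. ennreal (Y \<omega> ^ 4) \<partial>M) = ennreal (3 * (expectation (\<lambda>\<omega>. (Y \<omega>)\<^sup>2))\<^sup>2)"
  using Y mean proof (cases rule: centered_gaussian_cases)
    case zero
    then have "(\<integral>\<^sup>+\<omega>. ennreal (Y \<omega> ^ 4) \<partial>M) = (\<integral>\<^sup>+\<omega>. 0 \<partial>M)"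
      by (intro nn_integral_cong_AE) auto
    moreover have "expectation (\<lambda>\<omega>. (Y \<omega>)\<^sup>2) = expectation (\<lambda>\<omega>. 0)"
      using zero by (intro integral_cong_AE) auto
    ultimately show ?thesis by simp
  next
    case (normal \<sigma>)
    have var: "expectation (\<lambda>\<omega>. (Y \<omega>)\<^sup>2) = \<sigma>\<^sup>2"
      using normal_distributed_variance[OF normal] mean by simp
    have "(\<integral>\<^sup>+\<omega>. ennreal (Y \<omega> ^ 4) \<partial>M)
        = (\<integral>\<^sup>+x. ennreal (normal_density 0 \<sigma> x) * ennreal (x ^ 4) \<partial>lborel)"
      by (subst distributed_nn_integral[OF normal(2)]) auto
    \<comment> \<open>Written in the shape of \<open>normal_moment_even\<close> for mean 0 and
      exponent \<open>2 * 2\<close>.\<close>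
    also have "\<dots> = (\<integral>\<^sup>+x. ennreal (normal_density 0 \<sigma> x * (x - 0) ^ (2 * 2)) \<partial>lborel)"
      by (simp add: ennreal_mult')
    also have "\<dots> = ennreal (fact (2 * 2) / ((2 / \<sigma>\<^sup>2) ^ 2 * fact 2))"
      using normal_moment_even[OF normal(1), of 0 2]
      by (subst nn_integral_eq_integral) (auto simp: has_bochner_integral_iff)
    also have "fact (2 * 2) / ((2 / \<sigma>\<^sup>2) ^ 2 * fact 2) = 3 * (\<sigma>\<^sup>2)\<^sup>2"
      using normal(1) by (simp add: fact_numeral power2_eq_square field_simps)
    finally show ?thesis
      by (simp add: var)
  qed
  show "(\<integral>\<^sup>+\<omega>. ennreal (exp (t * (Y \<omega>)\<^sup>2)) \<partial>M) \<le> ennreal (sqrt 2)"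
    if t: "0 \<le> t" "t * expectation (\<lambda>\<omega>. (Y \<omega>)\<^sup>2) \<le> 1 / 4"
  using Y mean proof (cases rule: centered_gaussian_cases)
    case zero
    then have "(\<integral>\<^sup>+\<omega>. ennreal (exp (t * (Y \<omega>)\<^sup>2)) \<partial>M) = (\<integral>\<^sup>+\<omega>. 1 \<partial>M)"
      by (intro nn_integral_cong_AE) auto
    then show ?thesis by (simp add: emeasure_space_1)
  next
    case (normal \<sigma>)
    have var: "expectation (\<lambda>\<omega>. (Y \<omega>)\<^sup>2) = \<sigma>\<^sup>2"
      using normal_distributed_variance[OF normal] mean by simp
    \<comment> \<open>Multiplying the density by
      \<open>exp (x\<^sup>2 / (4 * \<sigma>\<^sup>2))\<close> doubles the variance in the exponent.
      The result is a normal density with standard deviation \<tau>, up to the ratio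
      \<open>sqrt 2\<close> of the normalizing constants.\<close>
    define \<tau> where "\<tau> = sqrt 2 * \<sigma>"
    have \<tau>: "0 < \<tau>" "\<tau>\<^sup>2 = 2 * \<sigma>\<^sup>2"
      using normal(1) by (auto simp: \<tau>_def power_mult_distrib)
    have density_le: "normal_density 0 \<sigma> x * exp (t * x\<^sup>2) \<le> sqrt 2 * normal_density 0 \<tau> x" for x
    proof -
      have "t \<le> 1 / (4 * \<sigma>\<^sup>2)"
        using t normal(1) by (simp add: var field_simps)
      then have "t * x\<^sup>2 \<le> 1 / (4 * \<sigma>\<^sup>2) * x\<^sup>2"
        by (intro mult_right_mono) auto
      moreover have "- x\<^sup>2 / (2 * \<sigma>\<^sup>2) + 1 / (4 * \<sigma>\<^sup>2) * x\<^sup>2 = - x\<^sup>2 / (2 * \<tau>\<^sup>2)"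
        using normal(1) by (simp add: \<tau> field_simps)
      ultimately have "- x\<^sup>2 / (2 * \<sigma>\<^sup>2) + t * x\<^sup>2 \<le> - x\<^sup>2 / (2 * \<tau>\<^sup>2)"
        by linarith
      then have "exp (- x\<^sup>2 / (2 * \<sigma>\<^sup>2)) * exp (t * x\<^sup>2) \<le> exp (- x\<^sup>2 / (2 * \<tau>\<^sup>2))"
        by (simp add: exp_add[symmetric])
      then have "1 / sqrt (2 * pi * \<sigma>\<^sup>2) * (exp (- x\<^sup>2 / (2 * \<sigma>\<^sup>2)) * exp (t * x\<^sup>2))
          \<le> 1 / sqrt (2 * pi * \<sigma>\<^sup>2) * exp (- x\<^sup>2 / (2 * \<tau>\<^sup>2))"
        by (intro mult_left_mono) auto
      moreover have "1 / sqrt (2 * pi * \<sigma>\<^sup>2) = sqrt 2 * (1 / sqrt (2 * pi * \<tau>\<^sup>2))"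
        using normal(1) by (simp add: \<tau> real_sqrt_mult field_simps)
      ultimately show ?thesis
        unfolding normal_density_def by (simp only: mult.assoc diff_zero)
    qed
    have "(\<integral>\<^sup>+\<omega>. ennreal (exp (t * (Y \<omega>)\<^sup>2)) \<partial>M)
        = (\<integral>\<^sup>+x. ennreal (normal_density 0 \<sigma> x) * ennreal (exp (t * x\<^sup>2)) \<partial>lborel)"
      by (subst distributed_nn_integral[OF normal(2)]) auto
    also have "\<dots> \<le> (\<integral>\<^sup>+x. ennreal (sqrt 2) * ennreal (normal_density 0 \<tau> x) \<partial>lborel)"
      using density_le by (intro nn_integral_mono) (auto simp: ennreal_mult'[symmetric] intro!: ennreal_leI)
    also have "\<dots> = ennreal (sqrt 2) * (\<integral>\<^sup>+x. ennreal (normal_density 0 \<tau> x) \<partial>lborel)"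
      by (intro nn_integral_cmult) auto
    also have "(\<integral>\<^sup>+x. ennreal (normal_density 0 \<tau> x) \<partial>lborel) = ennreal 1"
      using \<tau>(1) by (subst nn_integral_eq_integral) auto
    finally show ?thesis by simp
  qed
qed

text \<open>A vanishing \<open>expectation\<close> is no evidence of integrability, as the integral
  of a non-integrable function is 0 by default. Integrability comes from the finite second moment on
  a probability space.\<close>

lemma (in prob_space) integrable_centered_gaussian:
  assumes "gaussian_rv M Y" and "expectation Y = 0"
  shows "integrable M Y"
proof (rule square_integrable_imp_integrable)
  show "Y \<in> borel_measurable M"
    using assms(1) by (simp add: gaussian_rv_def)
  show "integrable M (\<lambda>\<omega>. (Y \<omega>)\<^sup>2)"
    by (rule centered_gaussian_moments(1)[OF assms])
qed

section \<open>From the covariance operator to moment bounds\<close>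

text \<open>Test the operator on finitely supported real sequences: Cauchy-Schwarz bounds the
  quadratic form by the norm of \<open>c\<close> times the norm of the image, and the image only
  loses norm when restricted to \<open>F\<close>. The absolute value of the operator bound supplies
  \<open>0 \<le> C\<close>.\<close>

lemma bounded_on_ell2_quadratic_form:
  assumes "bounded_on_ell2 K"
  shows "\<exists>C\<ge>0. \<forall>F c. finite F \<longrightarrow>
    (\<Sum>m\<in>F. \<Sum>n\<in>F. c m * c n * K m n) \<le> C * (\<Sum>n\<in>F. (c n)\<^sup>2)"
proof -
  obtain B where B: "\<And>x. x \<in> ell2 \<Longrightarrow> ell2_norm (matrix_apply K x) \<le> B * ell2_norm x"
    and ell2: "\<And>x. x \<in> ell2 \<Longrightarrow> matrix_apply K x \<in> ell2"
    using assms unfolding bounded_on_ell2_def by auto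
  have "(\<Sum>m\<in>F. \<Sum>n\<in>F. c m * c n * K m n) \<le> \<bar>B\<bar> * (\<Sum>n\<in>F. (c n)\<^sup>2)" if F: "finite F" for F c
  proof -
    define x where "x n = (if n \<in> F then complex_of_real (c n) else 0)" for n
    define y where "y m = (\<Sum>n\<in>F. K m n * c n)" for m
    have x0: "(cmod (x n))\<^sup>2 = 0" if "n \<notin> F" for n
      using that by (simp add: x_def)
    have x_ell2: "x \<in> ell2"
      unfolding ell2_def using summable_finite[OF F x0] by simp
    have norm_x: "ell2_norm x = L2_set c F"
      unfolding ell2_norm_def L2_set_def
      by (subst suminf_finite[OF F x0]) (auto simp: x_def norm_of_real intro!: arg_cong[where f=sqrt] sum.cong)
    have Kx: "matrix_apply K x m = complex_of_real (y m)" for m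
      unfolding matrix_apply_def
      by (subst suminf_finite[OF F]) (auto simp: x_def y_def)
    \<comment> \<open>Comparing a finite sum with \<open>suminf\<close> requires the image to lie in
      \<open>ell2\<close>.\<close>
    have "L2_set y F \<le> ell2_norm (matrix_apply K x)"
      using ell2[OF x_ell2] F unfolding L2_set_def ell2_norm_def ell2_def
      by (auto simp: Kx intro!: sum_le_suminf)
    also have "\<dots> \<le> B * L2_set c F"
      using B[OF x_ell2] norm_x by simp
    also have "\<dots> \<le> \<bar>B\<bar> * L2_set c F"
      by (intro mult_right_mono) (auto simp: L2_set_nonneg)
    finally have y: "L2_set y F \<le> \<bar>B\<bar> * L2_set c F" .
    have "(\<Sum>m\<in>F. \<Sum>n\<in>F. c m * c n * K m n) = (\<Sum>m\<in>F. c m * y m)"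
      by (auto simp: y_def sum_distrib_left intro!: sum.cong)
    also have "\<dots> \<le> (\<Sum>m\<in>F. \<bar>c m\<bar> * \<bar>y m\<bar>)"
      by (intro sum_mono) (metis abs_ge_self abs_mult)
    also have "\<dots> \<le> L2_set c F * L2_set y F"
      by (rule L2_set_mult_ineq)
    also have "\<dots> \<le> L2_set c F * (\<bar>B\<bar> * L2_set c F)"
      using y by (intro mult_left_mono) (auto simp: L2_set_nonneg)
    also have "\<dots> = \<bar>B\<bar> * (L2_set c F)\<^sup>2"
      by (simp add: power2_eq_square)
    also have "(L2_set c F)\<^sup>2 = (\<Sum>n\<in>F. (c n)\<^sup>2)"
      by (simp add: L2_set_def sum_nonneg)
    finally show ?thesis .
  qed
  then show ?thesis
    by (intro exI[of _ "\<bar>B\<bar>"]) auto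
qed

text \<open>A finite combination is centered Gaussian, and its variance is the quadratic form of the
  covariance matrix. Bounding that form turns the Gaussian moments into estimates uniform in
  \<open>F\<close> and \<open>c\<close>, the only form in which Gaussianity and the operator bound
  enter later.\<close>

lemma (in prob_space) gaussian_process_bounds:
  assumes process: "gaussian_process M X" and centered: "centered_process M X"
    and bounded: "bounded_on_ell2 (covariance_matrix M X)"
  obtains C where "0 < C"
    "\<And>F c. finite F \<Longrightarrow> (\<integral>\<^sup>+\<omega>. ennreal ((\<Sum>n\<in>F. c n * X n \<omega>) ^ 4) \<partial>M) \<le> ennreal (3 * (C * (\<Sum>n\<in>F. (c n)\<^sup>2))\<^sup>2)"
    "\<And>F c t. finite F \<Longrightarrow> 0 \<le> t \<Longrightarrow> t * (C * (\<Sum>n\<in>F. (c n)\<^sup>2)) \<le> 1 / 4 \<Longrightarrow>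
      (\<integral>\<^sup>+\<omega>. ennreal (exp (t * (\<Sum>n\<in>F. c n * X n \<omega>)\<^sup>2)) \<partial>M) \<le> ennreal (sqrt 2)"
proof -
  have gaussian: "gaussian_rv M (\<lambda>\<omega>. \<Sum>n\<in>F. c n * X n \<omega>)" if "finite F" for F c
    using process that by (simp add: gaussian_process_def)
  have X: "gaussian_rv M (X n)" "expectation (X n) = 0" for n
    using gaussian[of "{n}" "\<lambda>_. 1"] centered by (auto simp: centered_process_def)
  have [measurable]: "X n \<in> borel_measurable M" for n
    using X(1) by (simp add: gaussian_rv_def)
  have integrable_X: "integrable M (X n)" for n
    using integrable_centered_gaussian[OF X] .
  \<comment> \<open>Integrable products are what allows the variance to be expanded into a double
    sum of covariances.\<close>
  have integrable_XX: "integrable M (\<lambda>\<omega>. X m \<omega> * X n \<omega>)" for m n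
  proof (rule Bochner_Integration.integrable_bound)
    show "integrable M (\<lambda>\<omega>. (X m \<omega>)\<^sup>2 + (X n \<omega>)\<^sup>2)"
      by (intro Bochner_Integration.integrable_add centered_gaussian_moments(1) X)
    show "AE \<omega> in M. norm (X m \<omega> * X n \<omega>) \<le> norm ((X m \<omega>)\<^sup>2 + (X n \<omega>)\<^sup>2)"
    proof (rule AE_I2)
      fix \<omega>
      have "2 * (\<bar>X m \<omega>\<bar> * \<bar>X n \<omega>\<bar>) \<le> (X m \<omega>)\<^sup>2 + (X n \<omega>)\<^sup>2"
        using sum_squares_bound[of "\<bar>X m \<omega>\<bar>" "\<bar>X n \<omega>\<bar>"] by (simp add: mult.assoc)
      moreover have "0 \<le> \<bar>X m \<omega>\<bar> * \<bar>X n \<omega>\<bar>"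
        by simp
      ultimately have "\<bar>X m \<omega>\<bar> * \<bar>X n \<omega>\<bar> \<le> (X m \<omega>)\<^sup>2 + (X n \<omega>)\<^sup>2"
        by linarith
      then show "norm (X m \<omega> * X n \<omega>) \<le> norm ((X m \<omega>)\<^sup>2 + (X n \<omega>)\<^sup>2)"
        by (simp add: abs_mult)
    qed
  qed auto
  obtain C where C: "0 \<le> C" and quadratic: "\<And>F c. finite F \<Longrightarrow>
      (\<Sum>m\<in>F. \<Sum>n\<in>F. c m * c n * covariance_matrix M X m n) \<le> C * (\<Sum>n\<in>F. (c n)\<^sup>2)"
    using bounded_on_ell2_quadratic_form[OF bounded] by auto
  have mean: "expectation (\<lambda>\<omega>. \<Sum>n\<in>F. c n * X n \<omega>) = 0" for F and c :: "nat \<Rightarrow> real"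
    using integrable_X X(2) by (simp add: Bochner_Integration.integral_sum)
  \<comment> \<open>Enlarging \<open>C\<close> to \<open>C + 1\<close> makes the constant strictly
    positive, since it will be divided by.\<close>
  have var: "expectation (\<lambda>\<omega>. (\<Sum>n\<in>F. c n * X n \<omega>)\<^sup>2) \<le> (C + 1) * (\<Sum>n\<in>F. (c n)\<^sup>2)"
    if F: "finite F" for F c
  proof -
    have "expectation (\<lambda>\<omega>. (\<Sum>n\<in>F. c n * X n \<omega>)\<^sup>2)
        = expectation (\<lambda>\<omega>. \<Sum>m\<in>F. \<Sum>n\<in>F. c m * c n * (X m \<omega> * X n \<omega>))"
      by (simp add: power2_eq_square sum_product ac_simps)
    also have "\<dots> = (\<Sum>m\<in>F. \<Sum>n\<in>F. c m * c n * covariance_matrix M X m n)"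
      using integrable_XX X(2) by (simp add: Bochner_Integration.integral_sum covariance_matrix_def)
    also have "\<dots> \<le> C * (\<Sum>n\<in>F. (c n)\<^sup>2)"
      by (rule quadratic[OF F])
    also have "\<dots> \<le> (C + 1) * (\<Sum>n\<in>F. (c n)\<^sup>2)"
      by (intro mult_right_mono) (auto intro: sum_nonneg)
    finally show ?thesis .
  qed
  show ?thesis
  proof (rule that[of "C + 1"])
    show "(\<integral>\<^sup>+\<omega>. ennreal ((\<Sum>n\<in>F. c n * X n \<omega>) ^ 4) \<partial>M) \<le> ennreal (3 * ((C + 1) * (\<Sum>n\<in>F. (c n)\<^sup>2))\<^sup>2)"
      if "finite F" for F c
      unfolding centered_gaussian_moments(2)[OF gaussian[OF that] mean]
      by (intro ennreal_leI mult_left_mono power_mono var that) (auto intro: Bochner_Integration.integral_nonneg)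
    show "(\<integral>\<^sup>+\<omega>. ennreal (exp (t * (\<Sum>n\<in>F. c n * X n \<omega>)\<^sup>2)) \<partial>M) \<le> ennreal (sqrt 2)"
      if "finite F" "0 \<le> t" "t * ((C + 1) * (\<Sum>n\<in>F. (c n)\<^sup>2)) \<le> 1 / 4" for F c t
      using that order_trans[OF mult_left_mono[OF var[OF that(1)] that(2)] that(3)]
      by (intro centered_gaussian_moments(3) gaussian mean)
  qed (use C in simp)
qed

section \<open>Series with square-summable complex coefficients\<close>

text \<open>The variables are real, so the real and imaginary parts of \<open>b\<close> give two
  real series, and each satisfies the fourth moment criterion.\<close>

lemma (in prob_space) AE_summable_ell2_combination:
  fixes X :: "nat \<Rightarrow> 'a \<Rightarrow> real" and b :: "nat \<Rightarrow> complex"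
  assumes X[measurable]: "\<And>n. X n \<in> borel_measurable M" and C: "0 < C"
    and moment: "\<And>F c. finite F \<Longrightarrow> (\<integral>\<^sup>+\<omega>. ennreal ((\<Sum>n\<in>F. c n * X n \<omega>) ^ 4) \<partial>M)
      \<le> ennreal (3 * (C * (\<Sum>n\<in>F. (c n)\<^sup>2))\<^sup>2)"
    and b: "b \<in> ell2"
  shows "AE \<omega> in M. summable (\<lambda>n. b n * complex_of_real (X n \<omega>))"
proof -
  have real: "AE \<omega> in M. summable (\<lambda>n. c n * X n \<omega>)" if c: "summable (\<lambda>n. (c n)\<^sup>2)" for c :: "nat \<Rightarrow> real"
  \<comment> \<open>The factor 2 in the weights absorbs the Gaussian constant 3, as
    \<open>3 \<le> 2\<^sup>2\<close>.\<close>
  proof (rule AE_summable_if_fourth_moments[where u = "\<lambda>n. 2 * C * (c n)\<^sup>2"])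
    fix i j :: nat
    have "3 * (C * (\<Sum>n=i..<j. (c n)\<^sup>2))\<^sup>2 \<le> (\<Sum>n=i..<j. 2 * C * (c n)\<^sup>2)\<^sup>2"
      by (simp add: sum_distrib_left[symmetric] power_mult_distrib mult.assoc)
    then show "(\<integral>\<^sup>+\<omega>. ennreal ((\<Sum>n=i..<j. c n * X n \<omega>) ^ 4) \<partial>M)
        \<le> ennreal ((\<Sum>n=i..<j. 2 * C * (c n)\<^sup>2)\<^sup>2)"
      by (rule order_trans[OF moment[OF finite_atLeastLessThan] ennreal_leI])
  qed (use C c in \<open>auto intro: summable_mult\<close>)
  have "summable (\<lambda>n. (Re (b n))\<^sup>2)" "summable (\<lambda>n. (Im (b n))\<^sup>2)"
    using b unfolding ell2_def mem_Collect_eq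
    by (rule summable_comparison_test'[where N = 0], simp add: cmod_power2)+
  then have "AE \<omega> in M. summable (\<lambda>n. Re (b n) * X n \<omega>)" "AE \<omega> in M. summable (\<lambda>n. Im (b n) * X n \<omega>)"
    by (auto intro: real)
  then show ?thesis
    by eventually_elim (simp add: summable_complex_iff)
qed

text \<open>For a partial sum with real part \<open>U\<close> and imaginary part \<open>V\<close>,
  the exponential of \<open>t * (U\<^sup>2 + V\<^sup>2)\<close> is at most the sum of those of
  \<open>2 * t * U\<^sup>2\<close> and \<open>2 * t * V\<^sup>2\<close>. No independence of
  \<open>U\<close> and \<open>V\<close> enters, at the cost of doubling \<open>t\<close>. Fatou's
  lemma passes to the full series.\<close>

lemma (in prob_space) nn_integral_exp_ell2_combination_le:
  fixes X :: "nat \<Rightarrow> 'a \<Rightarrow> real" and b :: "nat \<Rightarrow> complex"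
  assumes X[measurable]: "\<And>n. X n \<in> borel_measurable M" and C: "0 < C"
    and exp_moment: "\<And>F c t. finite F \<Longrightarrow> 0 \<le> t \<Longrightarrow> t * (C * (\<Sum>n\<in>F. (c n)\<^sup>2)) \<le> 1 / 4 \<Longrightarrow>
      (\<integral>\<^sup>+\<omega>. ennreal (exp (t * (\<Sum>n\<in>F. c n * X n \<omega>)\<^sup>2)) \<partial>M) \<le> ennreal (sqrt 2)"
    and summable: "AE \<omega> in M. summable (\<lambda>n. b n * complex_of_real (X n \<omega>))"
    and t: "0 \<le> t" "2 * t * (C * s) \<le> 1 / 4" and s: "\<And>m. (\<Sum>n<m. (cmod (b n))\<^sup>2) \<le> s"
  shows "(\<integral>\<^sup>+\<omega>. ennreal (exp (t * (cmod (\<Sum>n. b n * complex_of_real (X n \<omega>)))\<^sup>2)) \<partial>M) \<le> ennreal (2 * sqrt 2)"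
proof -
  define f where "f m \<omega> = ennreal (exp (t * (cmod (\<Sum>n<m. b n * complex_of_real (X n \<omega>)))\<^sup>2))" for m \<omega>
  have [measurable]: "f m \<in> borel_measurable M" for m
    unfolding f_def by measurable
  have f_le: "(\<integral>\<^sup>+\<omega>. f m \<omega> \<partial>M) \<le> ennreal (2 * sqrt 2)" for m
  proof -
    define U where "U \<omega> = (\<Sum>n<m. Re (b n) * X n \<omega>)" for \<omega>
    define V where "V \<omega> = (\<Sum>n<m. Im (b n) * X n \<omega>)" for \<omega>
    have [measurable]: "U \<in> borel_measurable M" "V \<in> borel_measurable M"
      unfolding U_def V_def by measurable
    have part: "(\<integral>\<^sup>+\<omega>. ennreal (exp (2 * t * (\<Sum>n<m. c n * X n \<omega>)\<^sup>2)) \<partial>M) \<le> ennreal (sqrt 2)"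
      if "\<And>n. (c n)\<^sup>2 \<le> (cmod (b n))\<^sup>2" for c
    proof (rule exp_moment)
      have "(\<Sum>n<m. (c n)\<^sup>2) \<le> s"
        using that by (intro order_trans[OF sum_mono s]) auto
      then have "2 * t * (C * (\<Sum>n<m. (c n)\<^sup>2)) \<le> 2 * t * (C * s)"
        using t C by (intro mult_left_mono) auto
      then show "2 * t * (C * (\<Sum>n<m. (c n)\<^sup>2)) \<le> 1 / 4"
        using t(2) by simp
    qed (use t in auto)
    have "f m \<omega> \<le> ennreal (exp (2 * t * (U \<omega>)\<^sup>2)) + ennreal (exp (2 * t * (V \<omega>)\<^sup>2))" for \<omega>
    proof -
      have norm: "(cmod (\<Sum>n<m. b n * complex_of_real (X n \<omega>)))\<^sup>2 = (U \<omega>)\<^sup>2 + (V \<omega>)\<^sup>2"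
        by (simp add: cmod_power2 U_def V_def)
      \<comment> \<open>Bound \<open>p + q\<close> by twice the larger of the two.\<close>
      have max: "exp (t * (p + q)) \<le> exp (2 * t * p) + exp (2 * t * q)" for p q :: real
      proof (cases "p \<le> q")
        case True
        then have "t * (p + q) \<le> t * (2 * q)"
          using t(1) by (intro mult_left_mono) auto
        then show ?thesis
          by (simp add: add_increasing mult.left_commute)
      next
        case False
        then have "t * (p + q) \<le> t * (2 * p)"
          using t(1) by (intro mult_left_mono) auto
        then show ?thesis
          by (simp add: add_increasing2 mult.left_commute)
      qed
      show ?thesis
        unfolding f_def norm using ennreal_leI[OF max[of "(U \<omega>)\<^sup>2" "(V \<omega>)\<^sup>2"]] by simp
    qed
    then have "(\<integral>\<^sup>+\<omega>. f m \<omega> \<partial>M)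
        \<le> (\<integral>\<^sup>+\<omega>. ennreal (exp (2 * t * (U \<omega>)\<^sup>2)) + ennreal (exp (2 * t * (V \<omega>)\<^sup>2)) \<partial>M)"
      by (intro nn_integral_mono)
    also have "\<dots> = (\<integral>\<^sup>+\<omega>. ennreal (exp (2 * t * (U \<omega>)\<^sup>2)) \<partial>M) + (\<integral>\<^sup>+\<omega>. ennreal (exp (2 * t * (V \<omega>)\<^sup>2)) \<partial>M)"
      by (intro nn_integral_add) auto
    also have "\<dots> \<le> ennreal (sqrt 2) + ennreal (sqrt 2)"
      unfolding U_def V_def by (intro add_mono part) (auto simp: cmod_power2)
    also have "\<dots> = ennreal (2 * sqrt 2)"
      by (simp add: ennreal_plus[symmetric] del: ennreal_plus)
    finally show ?thesis .
  qed
  \<comment> \<open>Only almost everywhere: where the series diverges, \<open>suminf\<close> has no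
    relation to the partial sums.\<close>
  have "AE \<omega> in M. ennreal (exp (t * (cmod (\<Sum>n. b n * complex_of_real (X n \<omega>)))\<^sup>2)) = liminf (\<lambda>m. f m \<omega>)"
    using summable
  proof eventually_elim
    fix \<omega> assume "summable (\<lambda>n. b n * complex_of_real (X n \<omega>))"
    then have "(\<lambda>m. f m \<omega>) \<longlonglongrightarrow> ennreal (exp (t * (cmod (\<Sum>n. b n * complex_of_real (X n \<omega>)))\<^sup>2))"
      unfolding f_def by (intro tendsto_ennrealI tendsto_intros summable_LIMSEQ)
    then show "ennreal (exp (t * (cmod (\<Sum>n. b n * complex_of_real (X n \<omega>)))\<^sup>2)) = liminf (\<lambda>m. f m \<omega>)"
      by (rule lim_imp_Liminf[OF trivial_limit_sequentially, symmetric])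
  qed
  then have "(\<integral>\<^sup>+\<omega>. ennreal (exp (t * (cmod (\<Sum>n. b n * complex_of_real (X n \<omega>)))\<^sup>2)) \<partial>M)
      = (\<integral>\<^sup>+\<omega>. liminf (\<lambda>m. f m \<omega>) \<partial>M)"
    by (rule nn_integral_cong_AE)
  also have "\<dots> \<le> liminf (\<lambda>m. \<integral>\<^sup>+\<omega>. f m \<omega> \<partial>M)"
    by (rule nn_integral_liminf) auto
  also have "\<dots> \<le> ennreal (2 * sqrt 2)"
    using f_le by (intro Liminf_le) auto
  finally show ?thesis .
qed

section \<open>The random Fourier series\<close>

text \<open>Joint measurability is what exchanging null sets and integrals in \<omega> and \<theta>
  rests on.\<close>

lemma borel_measurable_random_fourier_term:
  assumes [measurable]: "\<And>n. X n \<in> borel_measurable M"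
  shows "(\<lambda>p. random_fourier_term a X (fst p) (snd p) n) \<in> borel_measurable (M \<Otimes>\<^sub>M lborel)"
  unfolding random_fourier_term_def by measurable

text \<open>For fixed \<theta> the deterministic factors form one coefficient with the modulus of
  \<open>a n\<close>, so the results on \<open>ell2\<close> combinations apply with bounds
  independent of \<theta>.\<close>

lemma random_fourier_term_altdef:
  "random_fourier_term a X \<omega> \<theta> n
    = (a n * exp (\<i> * of_nat n * complex_of_real \<theta>)) * complex_of_real (X n \<omega>)"
  by (simp add: random_fourier_term_def)

lemma norm_fourier_coefficient: "cmod (z * exp (\<i> * of_nat n * complex_of_real \<theta>)) = cmod z"
  using norm_exp_i_times[of "real n * \<theta>"] by (simp add: norm_mult mult.assoc)

theorem proposition4:
  fixes M :: "'w measure"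
    and X :: "nat \<Rightarrow> 'w \<Rightarrow> real"
    and a :: "nat \<Rightarrow> complex"
  assumes "prob_space M"
    and "gaussian_process M X"
    and "centered_process M X"
    and "bounded_on_ell2 (covariance_matrix M X)"
    and "a \<in> ell2"
  shows "(AE \<omega> in M. AE \<theta> in lborel. \<theta> \<in> {0..2*pi} \<longrightarrow>
            summable (\<lambda>n. random_fourier_term a X \<omega> \<theta> n)) \<and>
         (\<forall>l::real. 0 < l \<longrightarrow>
            (AE \<omega> in M.
               (\<integral>\<^sup>+\<theta>\<in>{0..2*pi}. ennreal (exp (l * (cmod (\<Sum>n. random_fourier_term a X \<omega> \<theta> n))\<^sup>2)) \<partial>lborel) < \<infinity>))"
proof -
  interpret prob_space M by fact
  interpret P: pair_sigma_finite M lborel ..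
  have X[measurable]: "X n \<in> borel_measurable M" for n
    using assms(2) by (simp add: gaussian_process_def)
  note measurable_term[measurable] = borel_measurable_random_fourier_term[OF X]
  obtain C where C: "0 < C"
    and moment: "\<And>F c. finite F \<Longrightarrow> (\<integral>\<^sup>+\<omega>. ennreal ((\<Sum>n\<in>F. c n * X n \<omega>) ^ 4) \<partial>M)
      \<le> ennreal (3 * (C * (\<Sum>n\<in>F. (c n)\<^sup>2))\<^sup>2)"
    and exp_moment: "\<And>F c t. finite F \<Longrightarrow> 0 \<le> t \<Longrightarrow> t * (C * (\<Sum>n\<in>F. (c n)\<^sup>2)) \<le> 1 / 4 \<Longrightarrow>
      (\<integral>\<^sup>+\<omega>. ennreal (exp (t * (\<Sum>n\<in>F. c n * X n \<omega>)\<^sup>2)) \<partial>M) \<le> ennreal (sqrt 2)"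
    using gaussian_process_bounds[OF assms(2-4)] by blast
  \<comment> \<open>Stated for any coefficient sequence because it serves both for \<open>a\<close>
    and for its tail \<open>tl\<close>.\<close>
  have summable_at: "AE \<omega> in M. summable (\<lambda>n. random_fourier_term a' X \<omega> \<theta> n)" if "a' \<in> ell2" for a' \<theta>
    unfolding random_fourier_term_altdef
    using that by (intro AE_summable_ell2_combination[OF X C moment])
      (auto simp: ell2_def norm_fourier_coefficient)
  have summable: "AE \<omega> in M. AE \<theta> in lborel. summable (\<lambda>n. random_fourier_term a X \<omega> \<theta> n)"
  proof (subst P.AE_commute)
    \<comment> \<open>Exchanging the quantifiers needs a measurable set of convergence; the Cauchy
      criterion describes it by the partial sums alone.\<close>
    show "{p \<in> space (M \<Otimes>\<^sub>M lborel). summable (\<lambda>n. random_fourier_term a X (fst p) (snd p) n)} \<in> sets (M \<Otimes>\<^sub>M lborel)"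
      unfolding summable_iff_convergent Cauchy_convergent_iff[symmetric] by measurable
    show "AE \<theta> in lborel. AE \<omega> in M. summable (\<lambda>n. random_fourier_term a X \<omega> \<theta> n)"
      using summable_at[OF assms(5)] by simp
  qed
  have "AE \<omega> in M. (\<integral>\<^sup>+\<theta>\<in>{0..2*pi}. ennreal (exp (l * (cmod (\<Sum>n. random_fourier_term a X \<omega> \<theta> n))\<^sup>2)) \<partial>lborel) < \<infinity>"
    if l: "0 < l" for l
  proof -
    have "summable (\<lambda>n. (cmod (a n))\<^sup>2)" "0 < 1 / (16 * l * C)"
      using assms(5) l C by (auto simp: ell2_def)
    \<comment> \<open>The exponential bound for the tail is used with \<open>t = 2 * l\<close>, and
      its condition \<open>2 * t * (C * s) \<le> 1 / 4\<close> becomes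
      \<open>s \<le> 1 / (16 * l * C)\<close>.\<close>
    then obtain N where N: "\<And>m. norm (\<Sum>n=N..<m. (cmod (a n))\<^sup>2) < 1 / (16 * l * C)"
      unfolding summable_Cauchy by blast
    \<comment> \<open>The head is set to zero, not shifted away, so each remaining coefficient keeps
      its frequency.\<close>
    define tl where "tl n = (if n < N then 0 else a n)" for n
    have tl_sum: "(\<Sum>n<m. (cmod (tl n))\<^sup>2) \<le> 1 / (16 * l * C)" for m
    proof -
      have "(\<Sum>n<m. (cmod (tl n))\<^sup>2) = (\<Sum>n=N..<m. (cmod (a n))\<^sup>2)"
        by (rule sum.mono_neutral_cong_right) (auto simp: tl_def)
      then show ?thesis
        using N[of m] by (simp add: sum_nonneg)
    qed
    have tl_ell2: "tl \<in> ell2"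
      using summable_comparison_test'[OF \<open>summable (\<lambda>n. (cmod (a n))\<^sup>2)\<close>, of 0 "\<lambda>n. (cmod (tl n))\<^sup>2"]
      by (simp add: ell2_def tl_def)
    \<comment> \<open>The parameter \<open>2 * l\<close> leaves room for splitting off the head, by
      \<open>(x + y)\<^sup>2 \<le> 2 * x\<^sup>2 + 2 * y\<^sup>2\<close>.\<close>
    define J where "J \<omega> \<theta> = ennreal (exp (2 * l * (cmod (\<Sum>n. random_fourier_term tl X \<omega> \<theta> n))\<^sup>2))
      * indicator {0..2*pi} \<theta>" for \<omega> \<theta>
    have J[measurable]: "case_prod J \<in> borel_measurable (M \<Otimes>\<^sub>M lborel)"
      unfolding J_def case_prod_unfold by measurable
    have tail: "(\<integral>\<^sup>+\<omega>. ennreal (exp (2 * l * (cmod (\<Sum>n. random_fourier_term tl X \<omega> \<theta> n))\<^sup>2)) \<partial>M) \<le> ennreal (2 * sqrt 2)" for \<theta>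
      unfolding random_fourier_term_altdef
    proof (rule nn_integral_exp_ell2_combination_le[OF X C exp_moment])
      show "AE \<omega> in M. summable (\<lambda>n. tl n * exp (\<i> * of_nat n * complex_of_real \<theta>) * complex_of_real (X n \<omega>))"
        using summable_at[OF tl_ell2, of \<theta>] by (simp add: random_fourier_term_altdef)
      show "2 * (2 * l) * (C * (1 / (16 * l * C))) \<le> 1 / 4"
        using l C by simp
      show "(\<Sum>n<m. (cmod (tl n * exp (\<i> * of_nat n * complex_of_real \<theta>)))\<^sup>2) \<le> 1 / (16 * l * C)" for m
        using tl_sum by (simp only: norm_fourier_coefficient)
    qed (use l in auto)
    have "(\<integral>\<^sup>+\<omega>. (\<integral>\<^sup>+\<theta>. J \<omega> \<theta> \<partial>lborel) \<partial>M) = (\<integral>\<^sup>+\<theta>. (\<integral>\<^sup>+\<omega>. J \<omega> \<theta> \<partial>M) \<partial>lborel)"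
      by (rule P.Fubini'[OF J, symmetric])
    also have "\<dots> \<le> (\<integral>\<^sup>+\<theta>. ennreal (2 * sqrt 2) * indicator {0..2*pi} \<theta> \<partial>lborel)"
      using tail by (intro nn_integral_mono) (auto simp: J_def split: split_indicator)
    also have "\<dots> = ennreal (2 * sqrt 2) * ennreal (2 * pi)"
      by (subst nn_integral_cmult_indicator) auto
    also have "\<dots> < \<infinity>"
      by (simp add: ennreal_mult_less_top)
    finally have "AE \<omega> in M. (\<integral>\<^sup>+\<theta>. J \<omega> \<theta> \<partial>lborel) \<noteq> \<infinity>"
      by (intro nn_integral_PInf_AE) auto
    with summable show ?thesis
    proof eventually_elim
      fix \<omega>
      assume \<omega>: "AE \<theta> in lborel. summable (\<lambda>n. random_fourier_term a X \<omega> \<theta> n)"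
        and finite: "(\<integral>\<^sup>+\<theta>. J \<omega> \<theta> \<partial>lborel) \<noteq> \<infinity>"
      \<comment> \<open>A bound for the head that depends on \<omega> but not on \<theta>, so its
        exponential is a finite constant in the integral over \<theta>.\<close>
      define B where "B = (\<Sum>n<N. cmod (a n) * \<bar>X n \<omega>\<bar>)"
      have [measurable]: "J \<omega> \<in> borel_measurable lborel"
        unfolding J_def random_fourier_term_def by measurable
      have "AE \<theta> in lborel. ennreal (exp (l * (cmod (\<Sum>n. random_fourier_term a X \<omega> \<theta> n))\<^sup>2)) * indicator {0..2*pi} \<theta>
          \<le> ennreal (exp (2 * l * B\<^sup>2)) * J \<omega> \<theta>"
        using \<omega>
      proof eventually_elim
        fix \<theta>
        assume \<theta>: "summable (\<lambda>n. random_fourier_term a X \<omega> \<theta> n)"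
        define S T H where "S = (\<Sum>n. random_fourier_term a X \<omega> \<theta> n)"
          and "T = (\<Sum>n. random_fourier_term tl X \<omega> \<theta> n)"
          and "H = (\<Sum>n<N. random_fourier_term a X \<omega> \<theta> n)"
        \<comment> \<open>Writing the head as a series and subtracting it yields both convergence
          and value of the tail series.\<close>
        have "(\<lambda>n. if n \<in> {..<N} then random_fourier_term a X \<omega> \<theta> n else 0) sums H"
          unfolding H_def by (rule sums_If_finite_set) simp
        from sums_diff[OF summable_sums[OF \<theta>] this]
        have "(\<lambda>n. random_fourier_term a X \<omega> \<theta> n
            - (if n \<in> {..<N} then random_fourier_term a X \<omega> \<theta> n else 0)) sums (S - H)"
          by (simp only: S_def)
        also have "(\<lambda>n. random_fourier_term a X \<omega> \<theta> n
            - (if n \<in> {..<N} then random_fourier_term a X \<omega> \<theta> n else 0)) = random_fourier_term tl X \<omega> \<theta>"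
          by (auto simp: fun_eq_iff tl_def random_fourier_term_def)
        finally have "random_fourier_term tl X \<omega> \<theta> sums (S - H)" .
        then have split: "S = H + T"
          by (simp add: T_def sums_iff)
        have "cmod H \<le> B"
          unfolding H_def B_def random_fourier_term_altdef
          by (intro order_trans[OF norm_sum] sum_mono)
            (simp add: norm_mult[of "_ * exp _"] norm_fourier_coefficient)
        have "cmod S \<le> B + cmod T"
          using norm_triangle_ineq[of H T] \<open>cmod H \<le> B\<close> by (simp add: split)
        then have "(cmod S)\<^sup>2 \<le> (B + cmod T)\<^sup>2"
          by (intro power_mono) auto
        also have "\<dots> \<le> 2 * B\<^sup>2 + 2 * (cmod T)\<^sup>2"
          using sum_squares_bound[of B "cmod T"] by (simp add: power2_sum)
        finally have "l * (cmod S)\<^sup>2 \<le> 2 * l * B\<^sup>2 + 2 * l * (cmod T)\<^sup>2"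
          using l mult_left_mono[of "(cmod S)\<^sup>2" "2 * B\<^sup>2 + 2 * (cmod T)\<^sup>2" l] by (simp add: algebra_simps)
        then have "exp (l * (cmod S)\<^sup>2) \<le> exp (2 * l * B\<^sup>2) * exp (2 * l * (cmod T)\<^sup>2)"
          by (simp add: exp_add[symmetric])
        then have "ennreal (exp (l * (cmod S)\<^sup>2)) \<le> ennreal (exp (2 * l * B\<^sup>2)) * ennreal (exp (2 * l * (cmod T)\<^sup>2))"
          by (subst ennreal_mult'[symmetric]) (auto intro: ennreal_leI)
        then show "ennreal (exp (l * (cmod (\<Sum>n. random_fourier_term a X \<omega> \<theta> n))\<^sup>2)) * indicator {0..2*pi} \<theta>
          \<le> ennreal (exp (2 * l * B\<^sup>2)) * J \<omega> \<theta>"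
          unfolding J_def S_def T_def by (auto split: split_indicator)
      qed
      then have "(\<integral>\<^sup>+\<theta>\<in>{0..2*pi}. ennreal (exp (l * (cmod (\<Sum>n. random_fourier_term a X \<omega> \<theta> n))\<^sup>2)) \<partial>lborel)
          \<le> (\<integral>\<^sup>+\<theta>. ennreal (exp (2 * l * B\<^sup>2)) * J \<omega> \<theta> \<partial>lborel)"
        by (rule nn_integral_mono_AE)
      also have "\<dots> = ennreal (exp (2 * l * B\<^sup>2)) * (\<integral>\<^sup>+\<theta>. J \<omega> \<theta> \<partial>lborel)"
        by (rule nn_integral_cmult) measurable
      also have "\<dots> < \<infinity>"
        using finite by (simp add: ennreal_mult_less_top less_top)
      finally show "(\<integral>\<^sup>+\<theta>\<in>{0..2*pi}. ennreal (exp (l * (cmod (\<Sum>n. random_fourier_term a X \<omega> \<theta> n))\<^sup>2)) \<partial>lborel) < \<infinity>" .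
    qed
  qed
  moreover have "AE \<omega> in M. AE \<theta> in lborel. \<theta> \<in> {0..2*pi} \<longrightarrow> summable (\<lambda>n. random_fourier_term a X \<omega> \<theta> n)"
    using summable by eventually_elim auto
  ultimately show ?thesis
    by blast
qed

end
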